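(* Let $\mathfrak g$ be a real Lie algebra and $\nabla$ a flat affine connection on $\mathfrak g$. Then $K(x,y)=(y,-x)$ defines a complex structure on the tangent algebra $T_\nabla\mathfrak g$ if and only if $\nabla$ is torsion-free. Moreover, if $\nabla$ is torsion-free then the connection $\nabla^1$ on $T_\nabla\mathfrak g$ defined by $$\nabla^1_{(x,y)}(z,w)=(\nabla_xz,\nabla_xw)$$ is a flat, torsion-free connection such that $\nabla^1K=0$. Conversely, if $\mathfrak u$ is a real Lie algebra with a complex structure $K$ such that $\mathfrak u$ decomposes as $\mathfrak u=\mathfrak g\oplus K\mathfrak g$, where $\mathfrak g$ is a subalgebra and $K\mathfrak g$ is an ideal of $\mathfrak u$, then $K\mathfrak g$ is abelian and there exists a flat, torsion-free connection $\nabla$ on $\mathfrak g$ such that $\mathfrak u$ is (isomorphic as a Lie algebra to) the tangent algebra $T_\nabla\mathfrak g$ of $(\mathfrak g,\nabla)$.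
   Context: Lie algebras are finite-dimensional over $\mathbb R$. A complex structure on a real Lie algebra $\mathfrak g$ is an endomorphism $J$ with $J^2=-1$ and $J[x,y]-[Jx,y]-[x,Jy]-J[Jx,Jy]=0$ for all $x,y\in\mathfrak g$. A connection on a Lie algebra $\mathfrak g$ is a linear map $\nabla:\mathfrak g\to\mathfrak{gl}(\mathfrak g)$, $x\mapsto\nabla_x$. It is flat if $\nabla_{[x,y]}=[\nabla_x,\nabla_y]$ for all $x,y$ (i.e. $\nabla$ is a representation), and torsion-free if $\nabla_xy-\nabla_yx=[x,y]$ for all $x,y$. For an endomorphism $K$, $\nabla K=0$ means $\nabla_xK=K\nabla_x$ for all $x$. For a flat connection $\nabla$ on $\mathfrak g$, the tangent algebra $T_\nabla\mathfrak g=\mathfrak g\oplus_\nabla\mathfrak g_a$ is the vector space $\mathfrak g\oplus\mathfrak g$ with bracket $[(x,u),(y,v)]=([x,y],\nabla_xv-\nabla_yu)$. *)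

theory Defs
  imports "HOL-Analysis.Analysis"
begin

text \<open>
  Lie algebras live on a linear subspace of an ambient real vector space, so that a subalgebra
  is again a Lie algebra with the same bracket.  Brackets, connections and endomorphisms are
  functions on the whole type, but only their values on the carrier matter.
\<close>

definition linear_between ::
  "'a::real_vector set \<Rightarrow> 'b::real_vector set \<Rightarrow> ('a \<Rightarrow> 'b) \<Rightarrow> bool" where
  "linear_between V W f \<longleftrightarrow>
     (\<forall>x\<in>V. f x \<in> W) \<and>
     (\<forall>x\<in>V. \<forall>y\<in>V. f (x + y) = f x + f y) \<and>
     (\<forall>c. \<forall>x\<in>V. f (c *\<^sub>R x) = c *\<^sub>R f x)"

definition bilinear_on :: "'a::real_vector set \<Rightarrow> ('a \<Rightarrow> 'a \<Rightarrow> 'a) \<Rightarrow> bool" where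
  "bilinear_on V b \<longleftrightarrow>
     (\<forall>x\<in>V. linear_between V V (\<lambda>y. b x y)) \<and> (\<forall>y\<in>V. linear_between V V (\<lambda>x. b x y))"

locale real_lie_algebra =
  fixes L :: "'a::real_vector set" and br :: "'a \<Rightarrow> 'a \<Rightarrow> 'a"
  assumes subspace: "subspace L"
    and finite_dim: "\<exists>B. finite B \<and> L = span B"
    and bilinear: "bilinear_on L br"
    and alternating: "x \<in> L \<Longrightarrow> br x x = 0"
    and jacobi: "x \<in> L \<Longrightarrow> y \<in> L \<Longrightarrow> z \<in> L \<Longrightarrow>
                   br x (br y z) + br y (br z x) + br z (br x y) = 0"

locale complex_structure = real_lie_algebra L br
  for L :: "'a::real_vector set" and br +
  fixes J :: "'a \<Rightarrow> 'a"
  assumes endo: "linear_between L L J"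
    and square: "x \<in> L \<Longrightarrow> J (J x) = - x"
    and integrable: "x \<in> L \<Longrightarrow> y \<in> L \<Longrightarrow>
                       J (br x y) - br (J x) y - br x (J y) - J (br (J x) (J y)) = 0"

text \<open>\<open>nabla x y\<close> is \<open>\<nabla>\<^sub>x y\<close>; bilinearity says that \<open>x \<mapsto> \<nabla>\<^sub>x\<close> is linear with values in
  the endomorphisms of the carrier.\<close>

locale lie_connection = real_lie_algebra L br
  for L :: "'a::real_vector set" and br +
  fixes nabla :: "'a \<Rightarrow> 'a \<Rightarrow> 'a"
  assumes connection: "bilinear_on L nabla"

definition flat_connection ::
  "'a::real_vector set \<Rightarrow> ('a \<Rightarrow> 'a \<Rightarrow> 'a) \<Rightarrow> ('a \<Rightarrow> 'a \<Rightarrow> 'a) \<Rightarrow> bool" where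
  "flat_connection L br nabla \<longleftrightarrow>
     (\<forall>x\<in>L. \<forall>y\<in>L. \<forall>z\<in>L. nabla (br x y) z = nabla x (nabla y z) - nabla y (nabla x z))"

definition torsion_free ::
  "'a::real_vector set \<Rightarrow> ('a \<Rightarrow> 'a \<Rightarrow> 'a) \<Rightarrow> ('a \<Rightarrow> 'a \<Rightarrow> 'a) \<Rightarrow> bool" where
  "torsion_free L br nabla \<longleftrightarrow>
     (\<forall>x\<in>L. \<forall>y\<in>L. nabla x y - nabla y x = br x y)"

definition parallel_endo ::
  "'a::real_vector set \<Rightarrow> ('a \<Rightarrow> 'a \<Rightarrow> 'a) \<Rightarrow> ('a \<Rightarrow> 'a) \<Rightarrow> bool" where
  "parallel_endo L nabla K \<longleftrightarrow> (\<forall>x\<in>L. \<forall>y\<in>L. nabla x (K y) = K (nabla x y))"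

text \<open>The tangent algebra of \<open>(g, nabla)\<close> has carrier \<open>g \<times> g\<close> and the following bracket.\<close>

definition tangent_br ::
  "('a::real_vector \<Rightarrow> 'a \<Rightarrow> 'a) \<Rightarrow> ('a \<Rightarrow> 'a \<Rightarrow> 'a) \<Rightarrow> 'a \<times> 'a \<Rightarrow> 'a \<times> 'a \<Rightarrow> 'a \<times> 'a" where
  "tangent_br br nabla = (\<lambda>(x, u) (y, v). (br x y, nabla x v - nabla y u))"

definition tangent_K :: "'a::real_vector \<times> 'a \<Rightarrow> 'a \<times> 'a" where
  "tangent_K = (\<lambda>(x, y). (y, - x))"

definition tangent_conn ::
  "('a::real_vector \<Rightarrow> 'a \<Rightarrow> 'a) \<Rightarrow> 'a \<times> 'a \<Rightarrow> 'a \<times> 'a \<Rightarrow> 'a \<times> 'a" where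
  "tangent_conn nabla = (\<lambda>(x, y) (z, w). (nabla x z, nabla x w))"

definition lie_subalgebra ::
  "'a::real_vector set \<Rightarrow> 'a set \<Rightarrow> ('a \<Rightarrow> 'a \<Rightarrow> 'a) \<Rightarrow> bool" where
  "lie_subalgebra S L br \<longleftrightarrow> subspace S \<and> S \<subseteq> L \<and> (\<forall>x\<in>S. \<forall>y\<in>S. br x y \<in> S)"

definition lie_ideal ::
  "'a::real_vector set \<Rightarrow> 'a set \<Rightarrow> ('a \<Rightarrow> 'a \<Rightarrow> 'a) \<Rightarrow> bool" where
  "lie_ideal I L br \<longleftrightarrow> subspace I \<and> I \<subseteq> L \<and> (\<forall>x\<in>L. \<forall>y\<in>I. br x y \<in> I)"

definition abelian_on :: "'a::real_vector set \<Rightarrow> ('a \<Rightarrow> 'a \<Rightarrow> 'a) \<Rightarrow> bool" where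
  "abelian_on S br \<longleftrightarrow> (\<forall>x\<in>S. \<forall>y\<in>S. br x y = 0)"

definition direct_sum_of :: "'a::real_vector set \<Rightarrow> 'a set \<Rightarrow> 'a set \<Rightarrow> bool" where
  "direct_sum_of L V W \<longleftrightarrow> L = {v + w | v w. v \<in> V \<and> w \<in> W} \<and> V \<inter> W = {0}"

definition lie_isomorphic ::
  "'a::real_vector set \<Rightarrow> ('a \<Rightarrow> 'a \<Rightarrow> 'a) \<Rightarrow> 'b::real_vector set \<Rightarrow> ('b \<Rightarrow> 'b \<Rightarrow> 'b) \<Rightarrow> bool" where
  "lie_isomorphic L br L' br' \<longleftrightarrow>
     (\<exists>f. linear_between L L' f \<and> bij_betw f L L' \<and>
          (\<forall>x\<in>L. \<forall>y\<in>L. f (br x y) = br' (f x) (f y)))"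

lemma finite_dim_Times:
  fixes A :: "'a::real_vector set" and B :: "'b::real_vector set"
  assumes "finite A" "finite B"
  shows "\<exists>C. finite C \<and> span A \<times> span B = span C"
proof -
  let ?C = "A \<times> {0} \<union> {0} \<times> B"
  have "span A \<times> span B = span ?C"
  proof
    show "span ?C \<subseteq> span A \<times> span B"
      by (rule span_minimal) (auto intro: span_base span_zero subspace_Times)
    show "span A \<times> span B \<subseteq> span ?C"
    proof clarify
      fix a b assume a: "a \<in> span A" and b: "b \<in> span B"
      have l1: "linear (\<lambda>x::'a. (x, 0::'b))" and l2: "linear (\<lambda>y::'b. (0::'a, y))"
        by (auto intro!: linearI)
      have "span ((\<lambda>x. (x, 0)) ` A) = (\<lambda>x::'a. (x, 0::'b)) ` span A"
        and "span ((\<lambda>y. (0, y)) ` B) = (\<lambda>y::'b. (0::'a, y)) ` span B"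
        using linear_span_image[OF l1] linear_span_image[OF l2] by auto
      then have "(a, 0) \<in> span ((\<lambda>x. (x, 0::'b)) ` A)" "(0, b) \<in> span ((\<lambda>y. (0::'a, y)) ` B)"
        using a b by auto
      moreover have "(\<lambda>x. (x, 0::'b)) ` A \<subseteq> ?C" "(\<lambda>y. (0::'a, y)) ` B \<subseteq> ?C"
        by auto
      ultimately have "(a, 0) \<in> span ?C" "(0, b) \<in> span ?C"
        by (meson span_mono subsetD)+
      from span_add[OF this] show "(a, b) \<in> span ?C" by simp
    qed
  qed
  moreover have "finite ?C" using assms by simp
  ultimately show ?thesis by blast
qed

lemma tangent_lie_algebra:
  assumes conn: "lie_connection g br nabla" and flat: "flat_connection g br nabla"
  shows "real_lie_algebra (g \<times> g) (tangent_br br nabla)"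
proof -
  interpret lie_connection g br nabla
    by (rule conn)
  have rules: "b (x + y) z = b x z + b y z" "b z (x + y) = b z x + b z y" "b x y \<in> g"
      "b (c *\<^sub>R x) y = c *\<^sub>R b x y" "b x (c *\<^sub>R y) = c *\<^sub>R b x y"
    if "bilinear_on g b" "x \<in> g" "y \<in> g" "z \<in> g" for b x y z c
    using that unfolding bilinear_on_def linear_between_def by simp_all
  note br_rules = rules[OF bilinear] and nabla_rules = rules[OF connection]
  note sub = subspace_add[OF subspace] subspace_diff[OF subspace] subspace_scale[OF subspace]
  have curv: "nabla (br x y) z = nabla x (nabla y z) - nabla y (nabla x z)"
    if "x \<in> g" "y \<in> g" "z \<in> g" for x y z
    using flat that by (simp add: flat_connection_def)
  have cl: "br x y \<in> g" "nabla x y \<in> g" if "x \<in> g" "y \<in> g" for x y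
    using that br_rules(3) nabla_rules(3) by blast+
  have diffr: "nabla x (y - z) = nabla x y - nabla x z" if "x \<in> g" "y \<in> g" "z \<in> g" for x y z
  proof -
    have "nabla x y = nabla x ((y - z) + z)" by simp
    also have "\<dots> = nabla x (y - z) + nabla x z"
      using that sub(2) nabla_rules(2) by blast
    finally show ?thesis by simp
  qed
  show ?thesis
  proof
    show "subspace (g \<times> g)" using subspace by (rule subspace_Times) (rule subspace)
    show "\<exists>B. finite B \<and> g \<times> g = span B"
      using finite_dim finite_dim_Times by blast
    show "bilinear_on (g \<times> g) (tangent_br br nabla)"
      unfolding bilinear_on_def linear_between_def tangent_br_def
      by (simp add: br_rules nabla_rules sub cl scaleR_diff_right)
    show "tangent_br br nabla x x = 0" if "x \<in> g \<times> g" for x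
      using that alternating by (auto simp: tangent_br_def zero_prod_def)
    show "tangent_br br nabla x (tangent_br br nabla y z) + tangent_br br nabla y (tangent_br br nabla z x)
        + tangent_br br nabla z (tangent_br br nabla x y) = 0"
      if "x \<in> g \<times> g" "y \<in> g \<times> g" "z \<in> g \<times> g" for x y z
      using that jacobi cl by (auto simp: tangent_br_def zero_prod_def curv diffr)
  qed
qed

end

theory Submission
  imports Defs
begin

text \<open>
  Integrability of \<open>K (x, y) = (y, - x)\<close> is a condition on the torsion
  \<open>T(x, y) = \<nabla>\<^sub>x y - \<nabla>\<^sub>y x - [x, y]\<close> alone: the Nijenhuis expression of \<open>K\<close> at \<open>(x, u)\<close> and
  \<open>(y, v)\<close> is \<open>(T(x, v) + T(u, y), T(x, y) - T(u, v))\<close>. It vanishes if \<open>T\<close> does, and at \<open>u = v = 0\<close>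
  it is \<open>(0, T(x, y))\<close>. The statements about \<open>\<nabla>\<^sup>1\<close> hold componentwise.

  For the converse let \<open>u = h \<oplus> K h\<close>. On \<open>h\<close> integrability reads
  \<open>K [x, y] - [K x, y] - [x, K y] = K [K x, K y]\<close>. As \<open>K h\<close> is an ideal and \<open>h\<close> a subalgebra, the
  left side lies in \<open>K h\<close>; since also \<open>[K x, K y] \<in> K h\<close>, the right side lies in \<open>K (K h) = h\<close>. Both
  sides therefore vanish: \<open>K h\<close> is abelian (\<open>abelian_K_image\<close>), and what is left
  of integrability says that \<open>\<nabla>\<^sub>x y = - K [x, K y]\<close> is torsion-free (\<open>induced_connection_torsion_free\<close>).
  This \<open>\<nabla>\<close> is the adjoint action of \<open>h\<close> on the ideal \<open>K h\<close>, carried over to \<open>h\<close> by \<open>K\<close>. Hence it is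
  flat by the Jacobi identity, and \<open>(x, y) \<mapsto> x + K y\<close> identifies the tangent algebra, in which the
  second summand is an abelian ideal with action \<open>\<nabla>\<close>, with \<open>u\<close>.
\<close>

section \<open>Linear and bilinear maps on a carrier\<close>

lemma linear_betweenD:
  assumes "linear_between V W f" "x \<in> V"
  shows "f x \<in> W" "y \<in> V \<Longrightarrow> f (x + y) = f x + f y" "f (c *\<^sub>R x) = c *\<^sub>R f x"
    "f (- x) = - f x" "f 0 = 0"
proof -
  show sc: "f (c *\<^sub>R x) = c *\<^sub>R f x" for c
    using assms by (simp add: linear_between_def)
  show "f (- x) = - f x" "f 0 = 0"
    using sc[of "-1"] sc[of 0] by simp_all
qed (use assms in \<open>auto simp: linear_between_def\<close>)

lemma bilinear_onD:
  assumes "bilinear_on V b" "x \<in> V" "y \<in> V"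
  shows "b x y \<in> V"
    "z \<in> V \<Longrightarrow> b (x + z) y = b x y + b z y" "z \<in> V \<Longrightarrow> b x (y + z) = b x y + b x z"
    "b (c *\<^sub>R x) y = c *\<^sub>R b x y" "b x (c *\<^sub>R y) = c *\<^sub>R b x y"
    "b (- x) y = - b x y" "b x (- y) = - b x y"
    "b 0 y = 0" "b x 0 = 0"
proof -
  have l: "linear_between V V (\<lambda>y. b x y)" and r: "linear_between V V (\<lambda>x. b x y)"
    using assms by (auto simp: bilinear_on_def)
  note L = linear_betweenD[OF l assms(3)] and R = linear_betweenD[OF r assms(2)]
  show "b x y \<in> V"
    "z \<in> V \<Longrightarrow> b (x + z) y = b x y + b z y" "z \<in> V \<Longrightarrow> b x (y + z) = b x y + b x z"
    "b (c *\<^sub>R x) y = c *\<^sub>R b x y" "b x (c *\<^sub>R y) = c *\<^sub>R b x y"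
    "b (- x) y = - b x y" "b x (- y) = - b x y"
    "b 0 y = 0" "b x 0 = 0"
    using L R by simp_all
qed

lemma finite_dim_subspace:
  assumes "subspace S" "S \<subseteq> span A" "finite A"
  shows "\<exists>B. finite B \<and> S = span B"
proof -
  obtain B where B: "B \<subseteq> S" "independent B" "S \<subseteq> span B"
    by (rule basis_exists[of S])
  have "finite B"
    using independent_span_bound[OF assms(3) B(2)] B(1) assms(2) by blast
  moreover have "span B \<subseteq> S"
    using B(1) assms(1) by (rule span_minimal)
  ultimately show ?thesis using B(3) by blast
qed

section \<open>Lie algebras, subalgebras and isomorphisms\<close>

context real_lie_algebra
begin

lemmas add_mem = subspace_add[OF subspace]
lemmas minus_mem = subspace_neg[OF subspace]
lemmas zero_mem = subspace_0[OF subspace]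
lemmas scale_mem = subspace_scale[OF subspace]
lemmas br_rules = bilinear_onD[OF bilinear]

lemma antisymmetric:
  assumes "x \<in> L" "y \<in> L"
  shows "br y x = - br x y"
proof -
  have "0 = br (x + y) (x + y)"
    using alternating add_mem assms by simp
  also have "\<dots> = br x (x + y) + br y (x + y)"
    using assms by (intro br_rules(2)) (simp_all add: add_mem)
  also have "\<dots> = br x y + br y x"
    using assms by (simp add: br_rules alternating)
  finally show ?thesis by (simp add: eq_neg_iff_add_eq_0 add.commute)
qed

lemma jacobi_derivation:
  assumes "x \<in> L" "y \<in> L" "z \<in> L"
  shows "br (br x y) z = br x (br y z) - br y (br x z)"
proof -
  have "br z (br x y) = - br (br x y) z" "br y (br z x) = - br y (br x z)"
    using antisymmetric[of "br x y" z] antisymmetric[of x z] assms by (simp_all add: br_rules)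
  with jacobi[OF assms] show ?thesis by (simp add: algebra_simps)
qed

lemma subalgebra_lie_algebra:
  assumes "lie_subalgebra S L br"
  shows "real_lie_algebra S br"
proof
  have sub: "subspace S" "S \<subseteq> L" and cl: "\<And>x y. x \<in> S \<Longrightarrow> y \<in> S \<Longrightarrow> br x y \<in> S"
    using assms by (auto simp: lie_subalgebra_def)
  have mem: "x \<in> L" if "x \<in> S" for x using that sub by blast
  show "subspace S" by (rule sub)
  show "\<exists>B. finite B \<and> S = span B"
    using finite_dim sub finite_dim_subspace by blast
  show "bilinear_on S br"
    unfolding bilinear_on_def linear_between_def by (simp add: cl br_rules mem)
  show "br x x = 0" if "x \<in> S" for x
    using that by (simp add: alternating mem)
  show "br x (br y z) + br y (br z x) + br z (br x y) = 0" if "x \<in> S" "y \<in> S" "z \<in> S" for x y z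
    using that by (simp add: jacobi mem)
qed

text \<open>The identification with the tangent algebra has the simple formula \<open>(x, y) \<mapsto> x + J y\<close> only in
  the direction out of the product; this lemma turns it around.\<close>

lemma lie_isomorphic_inverse:
  assumes lin: "linear_between L M f" and bij: "bij_betw f L M"
    and hom: "\<And>x y. x \<in> L \<Longrightarrow> y \<in> L \<Longrightarrow> f (br x y) = br' (f x) (f y)"
  shows "lie_isomorphic M br' L br"
  unfolding lie_isomorphic_def
proof (intro exI conjI ballI)
  let ?g = "inv_into L f"
  have g: "?g y \<in> L" "f (?g y) = y" if "y \<in> M" for y
    using that bij by (auto simp: bij_betw_def inv_into_into f_inv_into_f)
  have gf: "?g y = x" if "x \<in> L" "f x = y" for x y
    using that bij by (auto simp: bij_betw_def)
  have add: "?g (x + y) = ?g x + ?g y" if "x \<in> M" "y \<in> M" for x y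
    by (rule gf) (use g that in \<open>simp_all add: add_mem linear_betweenD[OF lin]\<close>)
  have scale: "?g (c *\<^sub>R x) = c *\<^sub>R ?g x" if "x \<in> M" for x c
    by (rule gf) (use g that in \<open>simp_all add: scale_mem linear_betweenD[OF lin]\<close>)
  show "linear_between M L ?g"
    unfolding linear_between_def using g add scale by auto
  show "bij_betw ?g M L"
    using bij by (rule bij_betw_inv_into)
  show "?g (br' x y) = br (?g x) (?g y)" if "x \<in> M" "y \<in> M" for x y
    by (rule gf) (use g that in \<open>simp_all add: br_rules hom\<close>)
qed

end

section \<open>The complex structure of the tangent algebra\<close>

text \<open>At two elements \<open>(x, 0)\<close> and \<open>(y, 0)\<close> of the first summand, the Nijenhuis expression is
  \<open>(0, \<nabla>\<^sub>x y - \<nabla>\<^sub>y x - [x, y])\<close>.\<close>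

lemma torsion_free_if_tangent_complex:
  assumes conn: "lie_connection g br nabla"
    and cs: "complex_structure (g \<times> g) (tangent_br br nabla) tangent_K"
  shows "torsion_free g br nabla"
  unfolding torsion_free_def
proof (intro ballI)
  fix x y assume xy: "x \<in> g" "y \<in> g"
  interpret lie_connection g br nabla by (rule conn)
  interpret cs: complex_structure "g \<times> g" "tangent_br br nabla" tangent_K by (rule cs)
  show "nabla x y - nabla y x = br x y"
    using cs.integrable[of "(x, 0)" "(y, 0)"] xy
    by (simp add: tangent_br_def tangent_K_def zero_mem br_rules bilinear_onD[OF connection]
        minus_mem zero_prod_def algebra_simps)
qed

text \<open>Once \<open>[x, y]\<close> is replaced by \<open>\<nabla>\<^sub>x y - \<nabla>\<^sub>y x\<close>, the terms of the Nijenhuis expression cancel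
  in pairs. Flatness makes the tangent
  algebra a Lie algebra.\<close>

lemma tangent_complex_if_torsion_free:
  assumes conn: "lie_connection g br nabla" and flat: "flat_connection g br nabla"
    and tf: "torsion_free g br nabla"
  shows "complex_structure (g \<times> g) (tangent_br br nabla) tangent_K"
proof -
  interpret lie_connection g br nabla by (rule conn)
  interpret T: real_lie_algebra "g \<times> g" "tangent_br br nabla"
    by (rule tangent_lie_algebra[OF conn flat])
  have br: "br x y = nabla x y - nabla y x" if "x \<in> g" "y \<in> g" for x y
    using tf that by (simp add: torsion_free_def)
  show ?thesis
  proof
    show "linear_between (g \<times> g) (g \<times> g) tangent_K"
      by (auto simp: linear_between_def tangent_K_def minus_mem)
    show "tangent_K (tangent_K x) = - x" if "x \<in> g \<times> g" for x
      by (cases x) (simp add: tangent_K_def)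
    show "tangent_K (tangent_br br nabla x y) - tangent_br br nabla (tangent_K x) y
        - tangent_br br nabla x (tangent_K y)
        - tangent_K (tangent_br br nabla (tangent_K x) (tangent_K y)) = 0"
      if "x \<in> g \<times> g" "y \<in> g \<times> g" for x y
      using that
      by (auto simp: tangent_br_def tangent_K_def zero_prod_def br bilinear_onD[OF connection]
          minus_mem algebra_simps)
  qed
qed

section \<open>The connection on the tangent algebra\<close>

lemma tangent_conn_connection:
  assumes conn: "lie_connection g br nabla" and flat: "flat_connection g br nabla"
  shows "lie_connection (g \<times> g) (tangent_br br nabla) (tangent_conn nabla)"
proof -
  interpret lie_connection g br nabla by (rule conn)
  interpret T: real_lie_algebra "g \<times> g" "tangent_br br nabla"
    by (rule tangent_lie_algebra[OF conn flat])
  show ?thesis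
    by unfold_locales
      (auto simp: bilinear_on_def linear_between_def tangent_conn_def bilinear_onD[OF connection])
qed

lemma tangent_conn_flat:
  assumes "flat_connection g br nabla"
  shows "flat_connection (g \<times> g) (tangent_br br nabla) (tangent_conn nabla)"
  using assms by (auto simp: flat_connection_def tangent_conn_def tangent_br_def)

lemma tangent_conn_torsion_free:
  assumes "torsion_free g br nabla"
  shows "torsion_free (g \<times> g) (tangent_br br nabla) (tangent_conn nabla)"
  using assms by (auto simp: torsion_free_def tangent_conn_def tangent_br_def)

lemma tangent_K_parallel:
  assumes "lie_connection g br nabla"
  shows "parallel_endo (g \<times> g) (tangent_conn nabla) tangent_K"
proof -
  interpret lie_connection g br nabla by (rule assms)
  show ?thesis
    by (auto simp: parallel_endo_def tangent_conn_def tangent_K_def bilinear_onD[OF connection])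
qed

section \<open>Complex structures with a totally real subalgebra and a complementary ideal\<close>

locale totally_real_splitting = complex_structure L br J
  for L :: "'a::real_vector set" and br J +
  fixes h :: "'a set"
  assumes subalgebra: "lie_subalgebra h L br"
    and ideal: "lie_ideal (J ` h) L br"
    and direct_sum: "direct_sum_of L h (J ` h)"
begin

lemmas J_rules = linear_betweenD[OF endo]

sublocale h: real_lie_algebra h br
  by (rule subalgebra_lie_algebra[OF subalgebra])

lemma J_diff:
  assumes "x \<in> L" "y \<in> L"
  shows "J (x - y) = J x - J y"
  using J_rules(2)[of x "- y"] J_rules(4)[of y] assms by (simp add: minus_mem)

lemma h_mem: "x \<in> h \<Longrightarrow> x \<in> L"
  using subalgebra by (auto simp: lie_subalgebra_def)

lemma ideal_mem: "x \<in> L \<Longrightarrow> y \<in> h \<Longrightarrow> br x (J y) \<in> J ` h"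
  using ideal by (auto simp: lie_ideal_def)

lemma J_swaps: "y \<in> J ` h \<Longrightarrow> J y \<in> h"
  by (auto simp: square h_mem h.minus_mem)

lemma h_J_disjoint: "x \<in> h \<Longrightarrow> x \<in> J ` h \<Longrightarrow> x = 0"
  using direct_sum unfolding direct_sum_of_def by blast

lemma integrable_h:
  assumes "x \<in> h" "y \<in> h"
  shows "J (br x y) = br x (J y) - br y (J x) + J (br (J x) (J y))"
  using integrable[of x y] antisymmetric[of y "J x"] assms
  by (simp add: h_mem J_rules algebra_simps)

text \<open>Solved for \<open>J [J x, J y]\<close>, integrability gives an element of \<open>J h\<close>; it also lies in \<open>h\<close>,
  because \<open>[J x, J y] \<in> J h\<close> and \<open>J\<close> exchanges \<open>h\<close> and \<open>J h\<close>.\<close>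

lemma abelian_K_image: "abelian_on (J ` h) br"
proof -
  have "br (J x) (J y) = 0" if xy: "x \<in> h" "y \<in> h" for x y
  proof -
    let ?b = "br (J x) (J y)"
    have b: "?b \<in> L" and bJ: "?b \<in> J ` h"
      using xy by (simp_all add: ideal_mem h_mem J_rules br_rules)
    have subJ: "subspace (J ` h)" using ideal by (simp add: lie_ideal_def)
    have "J ?b = J (br x y) - br x (J y) + br y (J x)"
      using integrable_h[OF xy] by (simp add: algebra_simps)
    also have "\<dots> \<in> J ` h"
      using xy by (intro subspace_add[OF subJ] subspace_diff[OF subJ])
        (auto simp: ideal_mem h_mem h.br_rules)
    finally have "J ?b = 0" by (rule h_J_disjoint[OF J_swaps[OF bJ]])
    then have "J (J ?b) = 0" using J_rules(5)[OF zero_mem] by simp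
    then show ?thesis using square[OF b] by simp
  qed
  then show ?thesis by (auto simp: abelian_on_def)
qed

text \<open>As \<open>J\<^sup>-\<^sup>1 = - J\<close>, this is the adjoint action of \<open>h\<close> on the ideal \<open>J h\<close>, transported to \<open>h\<close>
  by \<open>J\<close>.\<close>

definition induced_connection :: "'a \<Rightarrow> 'a \<Rightarrow> 'a" where
  "induced_connection x y = - J (br x (J y))"

lemma J_induced_connection:
  assumes "x \<in> h" "y \<in> h"
  shows "J (induced_connection x y) = br x (J y)"
  using assms by (simp add: induced_connection_def J_rules square br_rules h_mem)

lemma induced_connection_connection: "lie_connection h br induced_connection"
proof
  have "induced_connection x y \<in> h" if "x \<in> h" "y \<in> h" for x y
    using that by (simp add: induced_connection_def h.minus_mem J_swaps ideal_mem h_mem)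
  then show "bilinear_on h induced_connection"
    unfolding bilinear_on_def linear_between_def
    by (simp add: induced_connection_def h_mem br_rules J_rules)
qed

text \<open>In \<open>\<nabla>\<^sub>a \<nabla>\<^sub>b z\<close> the inner \<open>- J\<close> cancels against the outer \<open>J\<close>, so the flatness identity is
  \<open>- J\<close> applied to the Jacobi identity for \<open>x\<close>, \<open>y\<close> and \<open>J z\<close>.\<close>

lemma induced_connection_flat: "flat_connection h br induced_connection"
proof -
  interpret C: lie_connection h br induced_connection
    by (rule induced_connection_connection)
  show ?thesis
    unfolding flat_connection_def
  proof (intro ballI)
    fix x y z assume mem: "x \<in> h" "y \<in> h" "z \<in> h"
    have twice: "induced_connection a (induced_connection b z) = - J (br a (br b (J z)))"
      if "a \<in> h" "b \<in> h" for a b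
      using that mem bilinear_onD(1)[OF C.connection]
      by (simp add: induced_connection_def[of a] J_induced_connection)
    have "J (br (br x y) (J z)) = J (br x (br y (J z))) - J (br y (br x (J z)))"
      using mem by (simp add: jacobi_derivation h_mem J_rules J_diff br_rules)
    then show "induced_connection (br x y) z =
        induced_connection x (induced_connection y z) - induced_connection y (induced_connection x z)"
      using mem by (simp add: twice) (simp add: induced_connection_def)
  qed
qed

text \<open>Since \<open>J h\<close> is abelian, integrability on \<open>h\<close> is \<open>J [x, y] = [x, J y] - [y, J x]\<close>, the image
  under \<open>J\<close> of the vanishing of the torsion.\<close>

lemma induced_connection_torsion_free: "torsion_free h br induced_connection"
  unfolding torsion_free_def
proof (intro ballI)
  fix x y assume xy: "x \<in> h" "y \<in> h"
  have "J (br x y) = br x (J y) - br y (J x)"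
    using integrable_h[OF xy] abelian_K_image xy J_rules(5)[OF zero_mem]
    by (simp add: abelian_on_def)
  then have "- br x y = J (br x (J y)) - J (br y (J x))"
    using xy square[of "br x y"] by (simp add: br_rules J_rules J_diff h_mem)
  from arg_cong[OF this, of uminus] have "br x y = - (J (br x (J y)) - J (br y (J x)))"
    by simp
  then show "induced_connection x y - induced_connection y x = br x y"
    by (simp add: induced_connection_def)
qed

lemma bij_betw_splitting: "bij_betw (\<lambda>(x, y). x + J y) (h \<times> h) L"
  unfolding bij_betw_def
proof
  have uniq: "x = x' \<and> y = y'"
    if mem: "x \<in> h" "y \<in> h" "x' \<in> h" "y' \<in> h" and eq: "x + J y = x' + J y'" for x y x' y'
  proof -
    have "x - x' = (x + J y) - x' - J y" by simp
    also have "\<dots> = J y' - J y" unfolding eq by simp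
    also have "\<dots> = J (y' - y)" using mem by (simp add: J_diff h_mem)
    finally have "x - x' = J (y' - y)" .
    moreover have "x - x' \<in> h" "y' - y \<in> h"
      using mem by (simp_all add: subspace_diff[OF h.subspace])
    ultimately have x: "x - x' = 0" by (intro h_J_disjoint) simp_all
    then have "J y = J y'" using eq by simp
    then have "J (J y) = J (J y')" by simp
    then show ?thesis using x mem by (simp add: square h_mem)
  qed
  show "inj_on (\<lambda>(x, y). x + J y) (h \<times> h)"
  proof (rule inj_onI, clarify)
    fix x y x' y' assume "x \<in> h" "y \<in> h" "x' \<in> h" "y' \<in> h" "x + J y = x' + J y'"
    then show "x = x' \<and> y = y'" by (rule uniq)
  qed
  show "(\<lambda>(x, y). x + J y) ` (h \<times> h) = L"
  proof -
    have "L = {v + w | v w. v \<in> h \<and> w \<in> J ` h}"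
      using direct_sum by (simp add: direct_sum_of_def)
    also have "\<dots> = (\<lambda>(x, y). x + J y) ` (h \<times> h)" by auto
    finally show ?thesis by simp
  qed
qed

text \<open>The bracket \<open>[x + J p, y + J q]\<close> loses the term \<open>[J p, J q]\<close> because \<open>J h\<close> is abelian, and the
  mixed terms \<open>[x, J q] - [y, J p]\<close> are \<open>J (\<nabla>\<^sub>x q - \<nabla>\<^sub>y p)\<close>.\<close>

theorem isomorphic_tangent_algebra:
  "lie_isomorphic L br (h \<times> h) (tangent_br br induced_connection)"
proof -
  interpret C: lie_connection h br induced_connection
    by (rule induced_connection_connection)
  interpret T: real_lie_algebra "h \<times> h" "tangent_br br induced_connection"
    by (rule tangent_lie_algebra[OF induced_connection_connection induced_connection_flat])
  let ?f = "\<lambda>(x, y). x + J y"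
  show ?thesis
  proof (rule T.lie_isomorphic_inverse[where f = ?f])
    show "linear_between (h \<times> h) L ?f"
      by (auto simp: linear_between_def h_mem add_mem J_rules scaleR_add_right)
    show "bij_betw ?f (h \<times> h) L" by (rule bij_betw_splitting)
    fix X Y assume "X \<in> h \<times> h" "Y \<in> h \<times> h"
    then obtain x p y q where XY: "X = (x, p)" "Y = (y, q)"
      and mem: "x \<in> h" "p \<in> h" "y \<in> h" "q \<in> h" by auto
    have cl: "induced_connection a b \<in> h" if "a \<in> h" "b \<in> h" for a b
      using that by (rule bilinear_onD(1)[OF C.connection])
    have "J (induced_connection x q - induced_connection y p) = br x (J q) - br y (J p)"
      using mem by (simp add: cl h_mem J_diff J_induced_connection)
    moreover have "br (J p) (J q) = 0" "br (J p) y = - br y (J p)"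
      using abelian_K_image mem antisymmetric[of y "J p"]
      by (simp_all add: abelian_on_def h_mem J_rules)
    ultimately show "?f (tangent_br br induced_connection X Y) = br (?f X) (?f Y)"
      using mem by (simp add: XY tangent_br_def br_rules add_mem h_mem J_rules)
  qed
qed

end

section \<open>Torsion-free flat connections and complex structures\<close>

theorem theorem4p1:
  fixes g :: "'a::real_vector set" and br nabla :: "'a \<Rightarrow> 'a \<Rightarrow> 'a"
    and u h :: "'b::real_vector set" and br' :: "'b \<Rightarrow> 'b \<Rightarrow> 'b" and K :: "'b \<Rightarrow> 'b"
  shows
    "(real_lie_algebra g br \<and> lie_connection g br nabla \<and> flat_connection g br nabla \<longrightarrow>
        (complex_structure (g \<times> g) (tangent_br br nabla) tangent_K \<longleftrightarrow> torsion_free g br nabla) \<and>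
        (torsion_free g br nabla \<longrightarrow>
           lie_connection (g \<times> g) (tangent_br br nabla) (tangent_conn nabla) \<and>
           flat_connection (g \<times> g) (tangent_br br nabla) (tangent_conn nabla) \<and>
           torsion_free (g \<times> g) (tangent_br br nabla) (tangent_conn nabla) \<and>
           parallel_endo (g \<times> g) (tangent_conn nabla) tangent_K)) \<and>
     (real_lie_algebra u br' \<and> complex_structure u br' K \<and>
        lie_subalgebra h u br' \<and> lie_ideal (K ` h) u br' \<and> direct_sum_of u h (K ` h) \<longrightarrow>
        abelian_on (K ` h) br' \<and>
        (\<exists>nabla'. lie_connection h br' nabla' \<and> flat_connection h br' nabla' \<and>
           torsion_free h br' nabla' \<and>
           lie_isomorphic u br' (h \<times> h) (tangent_br br' nabla')))"
proof (intro conjI impI; (elim conjE)?)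
  assume conn: "lie_connection g br nabla" and flat: "flat_connection g br nabla"
  show "complex_structure (g \<times> g) (tangent_br br nabla) tangent_K \<longleftrightarrow> torsion_free g br nabla"
    using torsion_free_if_tangent_complex[OF conn] tangent_complex_if_torsion_free[OF conn flat]
    by blast
  show "lie_connection (g \<times> g) (tangent_br br nabla) (tangent_conn nabla)"
    by (rule tangent_conn_connection[OF conn flat])
  show "flat_connection (g \<times> g) (tangent_br br nabla) (tangent_conn nabla)"
    by (rule tangent_conn_flat[OF flat])
  show "parallel_endo (g \<times> g) (tangent_conn nabla) tangent_K"
    by (rule tangent_K_parallel[OF conn])
next
  assume "torsion_free g br nabla"
  then show "torsion_free (g \<times> g) (tangent_br br nabla) (tangent_conn nabla)"
    by (rule tangent_conn_torsion_free)
next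
  assume "complex_structure u br' K" "lie_subalgebra h u br'" "lie_ideal (K ` h) u br'"
    "direct_sum_of u h (K ` h)"
  then interpret totally_real_splitting u br' K h
    by (intro totally_real_splitting.intro totally_real_splitting_axioms.intro)
  show "abelian_on (K ` h) br'"
    by (rule abelian_K_image)
  show "\<exists>nabla'. lie_connection h br' nabla' \<and> flat_connection h br' nabla' \<and>
      torsion_free h br' nabla' \<and> lie_isomorphic u br' (h \<times> h) (tangent_br br' nabla')"
    using induced_connection_connection induced_connection_flat induced_connection_torsion_free
      isomorphic_tangent_algebra by blast
qed

end
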